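(* Let $t>0$ and $R\in\mathbb N$, $R\ge1$. For all $\alpha,\beta\in K(X,A)$, $$\mathbb E\bigl[\langle\Phi_{t,R}(\alpha),\Phi_{t,R}(\beta)\rangle\bigr]=k_t(\alpha,\beta),$$ where the inner product is the Euclidean one on $\mathbb R^{2R}$.
   Context: Setting: $(X,d)$ is a metric space and $A\subseteq X$ is nonempty with $X\setminus A=\{x_1,\dots,x_N\}$ finite, $N\ge1$. Write $d(x,A)=\inf_{a\in A}d(x,a)$ and $d_1(x,y):=\min\{d(x,y),\,d(x,A)+d(y,A)\}$. Let $X/A=\{[A],x_1,\dots,x_N\}$ be the quotient collapsing $A$ to the basepoint $[A]$, and let $\overline d_1$ be the function on $X/A$ induced by $d_1$; it is assumed to be a metric on $X/A$ (equivalently $d(x_j,A)>0$ for all $j$). $K(X,A)$ (the virtual persistence diagram group) is the Grothendieck group of the free commutative monoid on $X\setminus A$, identified with the free abelian group $\mathbb Z^{N}$ with basis $e_1,\dots,e_N$, where $e_j$ is the class of $x_j$. Characters and phases: $\mathbb T^{N}=\mathbb R^{N}/2\pi\mathbb Z^{N}$ with normalized Haar (Lebesgue) probability measure $\mu$. For $\alpha=\sum_j n_je_j\in K(X,A)$ and $\theta\in\mathbb T^N$, $\langle\alpha,\theta\rangle=\sum_j n_j\theta_j$ (mod $2\pi$) and $\chi_\theta(\alpha)=e^{i\langle\alpha,\theta\rangle}$. The phase function $\phi_\theta:X/A\to S^1\subset\mathbb C$ is $\phi_\theta([A])=1$, $\phi_\theta(x_j)=e^{i\theta_j}$. Graph model: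 fix a connected (simple, undirected) graph $H=(V,E)$ with $V=X/A$ such that, when each edge $\{u,v\}$ is given length $\overline d_1(u,v)$, the shortest-path metric of $H$ is $\overline d_1$. Fix symmetric conductances $w_{uv}=w_{vu}>0$ for $\{u,v\}\in E$, with $w_{uv}=0$ if $\{u,v\}\notin E$. The Dirichlet energy is $\lambda(\theta):=\tfrac12\sum_{u,v\in V}w_{uv}|\phi_\theta(u)-\phi_\theta(v)|^2$, with $|\cdot|$ the complex modulus. Heat kernel and random features: $d\nu_t(\theta)=e^{-t\lambda(\theta)}d\mu(\theta)$ on $\mathbb T^N$ and $k_t(\alpha,\beta)=\int_{\mathbb T^N}\chi_\theta(\alpha-\beta)\,d\nu_t(\theta)$. Let $\theta^{(1)},\dots,\theta^{(R)}$ be independent samples from the probability measure $\nu_t/\nu_t(\mathbb T^N)$ and $$\Phi_{t,R}(\alpha):=\sqrt{\frac{\nu_t(\mathbb T^N)}{R}}\,\bigl(\cos\langle\alpha,\theta^{(r)}\rangle,\ \sin\langle\alpha,\theta^{(r)}\rangle\bigr)_{r=1}^R\in\mathbb R^{2R}.$$ *)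

theory Defs
  imports
    "HOL-Probability.Probability"
    "HOL-Algebra.Free_Abelian_Groups"
    "Graph_Theory.Pair_Digraph"
    "Graph_Theory.Digraph_Component"
    "Graph_Theory.Shortest_Path"
begin

section \<open>The quotient pointed metric space\<close>

text \<open>
  The metric space \<open>X\<close> is the whole type \<open>'a::metric_space\<close>, so \<open>X \ A\<close> is \<open>- A\<close>, and
  \<open>d(x, A)\<close> is \<open>infdist x A\<close>.  The points \<open>x_1, \<dots>, x_N\<close> serve as their own indices:
  families indexed by \<open>{1..N}\<close> become families indexed by \<open>- A\<close>.
\<close>

definition d1 :: "'a::metric_space set \<Rightarrow> 'a \<Rightarrow> 'a \<Rightarrow> real" where
  "d1 A x y = min (dist x y) (infdist x A + infdist y A)"

definition collapse_rel :: "'a set \<Rightarrow> ('a \<times> 'a) set" where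
  "collapse_rel A = {(x, y). x = y \<or> x \<in> A \<and> y \<in> A}"

text \<open>The elements of \<open>X/A\<close> are the basepoint \<open>A\<close> and the singletons \<open>{x}\<close> with \<open>x \<notin> A\<close>.\<close>

definition collapse :: "'a set \<Rightarrow> 'a set set" where
  "collapse A = UNIV // collapse_rel A"

text \<open>The chosen representatives are immaterial, see \<open>d1_bar_class\<close> below.\<close>

definition d1_bar :: "'a::metric_space set \<Rightarrow> 'a set \<Rightarrow> 'a set \<Rightarrow> real" where
  "d1_bar A P Q = d1 A (SOME x. x \<in> P) (SOME y. y \<in> Q)"

lemma collapse_class: "collapse_rel A `` {x} = (if x \<in> A then A else {x})"
  by (auto simp: collapse_rel_def)

lemma collapse_eq: "A \<noteq> {} \<Longrightarrow> collapse A = insert A ((\<lambda>x. {x}) ` (- A))"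
  by (auto simp: collapse_def quotient_def collapse_class split: if_splits)

lemma d1_cong_left:
  assumes "x \<in> A" "x' \<in> A"
  shows "d1 A x y = d1 A x' y"
proof -
  have "infdist y A \<le> dist z y" if "z \<in> A" for z
    using infdist_le[OF that, of y] by (simp add: dist_commute)
  then show ?thesis
    using assms by (simp add: d1_def)
qed

lemma d1_commute: "d1 A x y = d1 A y x"
  by (simp add: d1_def dist_commute add.commute)

lemma d1_bar_class:
  "d1_bar A (collapse_rel A `` {x}) (collapse_rel A `` {y}) = d1 A x y"
proof -
  have rep: "d1 A (SOME u. u \<in> collapse_rel A `` {x}) z = d1 A x z" for x z
    using d1_cong_left[OF someI[of "\<lambda>u. u \<in> A" x]] by (auto simp: collapse_class)
  show ?thesis
    unfolding d1_bar_def by (metis rep d1_commute)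
qed

section \<open>The virtual persistence diagram group\<close>

text \<open>
  The free abelian group on \<open>X \ A\<close>, the Grothendieck group of the free commutative monoid
  on that set: finitely supported integer-valued functions with support in \<open>- A\<close>.
\<close>

abbreviation vpd_group :: "'a set \<Rightarrow> ('a \<Rightarrow>\<^sub>0 int) monoid" where
  "vpd_group A \<equiv> free_Abelian_group (- A)"

section \<open>The torus and its Haar measure\<close>

definition torus_rel :: "'i set \<Rightarrow> (('i \<Rightarrow> real) \<times> ('i \<Rightarrow> real)) set" where
  "torus_rel I = {(u, v). u \<in> (I \<rightarrow>\<^sub>E UNIV) \<and> v \<in> (I \<rightarrow>\<^sub>E UNIV) \<and>
     (\<forall>i\<in>I. \<exists>k::int. u i - v i = 2 * pi * of_int k)}"

definition torus :: "'i set \<Rightarrow> ('i \<Rightarrow> real) set set" where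
  "torus I = (I \<rightarrow>\<^sub>E UNIV) // torus_rel I"

definition torus_class :: "'i set \<Rightarrow> ('i \<Rightarrow> real) \<Rightarrow> ('i \<Rightarrow> real) set" where
  "torus_class I v = torus_rel I `` {v}"

text \<open>The Borel sets of the torus are those with Borel preimage in \<open>\<real>\<^sup>I\<close>.\<close>

definition torus_borel :: "'i set \<Rightarrow> ('i \<Rightarrow> real) set measure" where
  "torus_borel I = sigma (torus I)
     {B. B \<subseteq> torus I \<and> torus_class I -` B \<inter> (I \<rightarrow>\<^sub>E UNIV) \<in> sets (Pi\<^sub>M I (\<lambda>_. borel))}"

text \<open>Normalized Lebesgue measure on the fundamental cube \<open>[0, 2\<pi>)\<^sup>I\<close>, pushed to the quotient.\<close>

definition haar :: "'i set \<Rightarrow> ('i \<Rightarrow> real) set measure" where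
  "haar I = distr (Pi\<^sub>M I (\<lambda>_. uniform_measure lborel {0..<2 * pi})) (torus_borel I) (torus_class I)"

lemma torus_class_measurable:
  "torus_class I \<in> measurable (Pi\<^sub>M I (\<lambda>_. uniform_measure lborel {0..<2 * pi})) (torus_borel I)"
proof -
  let ?P = "Pi\<^sub>M I (\<lambda>_. uniform_measure lborel {0..<2 * pi}) :: ('a \<Rightarrow> real) measure"
  have sp: "space ?P = (I \<rightarrow>\<^sub>E UNIV)"
    by (simp add: space_PiM)
  have se: "sets ?P = sets (Pi\<^sub>M I (\<lambda>_. borel))"
    by (intro sets_PiM_cong) auto
  show ?thesis
    unfolding torus_borel_def
    by (rule measurable_measure_of)
       (auto simp: sp se torus_def torus_class_def quotient_def)
qed

lemma prob_space_haar: "prob_space (haar I)"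
proof -
  have "prob_space (uniform_measure lborel {0..<2 * pi})"
    by (rule prob_space_uniform_measure) auto
  then have "prob_space (Pi\<^sub>M I (\<lambda>_. uniform_measure lborel {0..<2 * pi}))"
    by (intro prob_space_PiM)
  then show ?thesis
    unfolding haar_def by (rule prob_space.prob_space_distr) (rule torus_class_measurable)
qed

text \<open>
  A representative in \<open>\<real>\<^sup>I\<close> of a point of the torus.  The real number \<open>pairing A \<alpha> \<theta>\<close> is thus
  meaningful only modulo \<open>2\<pi>\<close>; it occurs only inside \<open>cis\<close>, \<open>cos\<close> and \<open>sin\<close>, and
  \<open>character_class\<close> and \<open>phase_class\<close> below show independence of the choice.
\<close>

definition angles :: "('i \<Rightarrow> real) set \<Rightarrow> 'i \<Rightarrow> real" where
  "angles \<theta> = (SOME v. v \<in> \<theta>)"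

definition pairing :: "'a set \<Rightarrow> ('a \<Rightarrow>\<^sub>0 int) \<Rightarrow> ('a \<Rightarrow> real) set \<Rightarrow> real" where
  "pairing A \<alpha> \<theta> = (\<Sum>x\<in>- A. of_int (Poly_Mapping.lookup \<alpha> x) * angles \<theta> x)"

definition character :: "'a set \<Rightarrow> ('a \<Rightarrow> real) set \<Rightarrow> ('a \<Rightarrow>\<^sub>0 int) \<Rightarrow> complex" where
  "character A \<theta> \<alpha> = cis (pairing A \<alpha> \<theta>)"

definition phase :: "'a set \<Rightarrow> ('a \<Rightarrow> real) set \<Rightarrow> 'a set \<Rightarrow> complex" where
  "phase A \<theta> P = (if P = A then 1 else cis (angles \<theta> (the_elem P)))"

lemma angles_torus_class:
  assumes "v \<in> (I \<rightarrow>\<^sub>E UNIV)" "i \<in> I"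
  shows "\<exists>k::int. angles (torus_class I v) i = v i + 2 * pi * of_int k"
proof -
  have "v \<in> torus_class I v"
    using assms(1) by (auto simp: torus_class_def torus_rel_def intro!: exI[of _ "0::int"])
  then have "angles (torus_class I v) \<in> torus_class I v"
    unfolding angles_def by (rule someI[of "\<lambda>u. u \<in> torus_class I v"])
  then obtain k :: int where "v i - angles (torus_class I v) i = 2 * pi * of_int k"
    using assms(2) by (auto simp: torus_class_def torus_rel_def)
  then show ?thesis
    by (intro exI[of _ "- k"]) simp
qed

lemma cis_add_2pi: "cis (x + 2 * pi * of_int k) = cis x"
  by (simp add: cis_mult[symmetric] cis_multiple_2pi)

lemma cis_sum: "finite S \<Longrightarrow> cis (\<Sum>i\<in>S. f i) = (\<Prod>i\<in>S. cis (f i))"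
  by (induction S rule: finite_induct) (auto simp: cis_mult[symmetric])

lemma character_class:
  assumes "finite (- A)" "v \<in> (- A \<rightarrow>\<^sub>E UNIV)"
  shows "character A (torus_class (- A) v) \<alpha>
           = cis (\<Sum>x\<in>- A. of_int (Poly_Mapping.lookup \<alpha> x) * v x)"
proof -
  have "cis (of_int n * angles (torus_class (- A) v) x) = cis (of_int n * v x)"
    if x: "x \<in> - A" for x and n :: int
  proof -
    obtain k :: int where k: "angles (torus_class (- A) v) x = v x + 2 * pi * of_int k"
      using angles_torus_class[OF assms(2) x] by blast
    have "of_int n * angles (torus_class (- A) v) x
            = of_int n * v x + 2 * pi * of_int (n * k)"
      by (simp add: k algebra_simps)
    then show ?thesis
      by (simp only: cis_add_2pi)
  qed
  then show ?thesis
    using assms(1) by (simp add: character_def pairing_def cis_sum)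
qed

lemma phase_class:
  assumes "A \<noteq> {}" "v \<in> (- A \<rightarrow>\<^sub>E UNIV)"
  shows "phase A (torus_class (- A) v) A = 1"
    and "x \<notin> A \<Longrightarrow> phase A (torus_class (- A) v) {x} = cis (v x)"
proof -
  show "phase A (torus_class (- A) v) A = 1"
    by (simp add: phase_def)
  assume x: "x \<notin> A"
  then obtain k :: int where "angles (torus_class (- A) v) x = v x + 2 * pi * of_int k"
    using angles_torus_class[OF assms(2), of x] by auto
  moreover have "{x} \<noteq> A"
    using x by auto
  ultimately show "phase A (torus_class (- A) v) {x} = cis (v x)"
    by (simp add: phase_def cis_add_2pi)
qed

section \<open>Heat kernel and random features\<close>

definition dirichlet_energy ::
    "'a set \<Rightarrow> ('a set \<Rightarrow> 'a set \<Rightarrow> real) \<Rightarrow> ('a \<Rightarrow> real) set \<Rightarrow> real" where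
  "dirichlet_energy A w \<theta> =
     1 / 2 * (\<Sum>u\<in>collapse A. \<Sum>v\<in>collapse A. w u v * (cmod (phase A \<theta> u - phase A \<theta> v))\<^sup>2)"

definition heat_measure ::
    "'a set \<Rightarrow> ('a set \<Rightarrow> 'a set \<Rightarrow> real) \<Rightarrow> real \<Rightarrow> ('a \<Rightarrow> real) set measure" where
  "heat_measure A w t =
     density (haar (- A)) (\<lambda>\<theta>. ennreal (exp (- t * dirichlet_energy A w \<theta>)))"

definition heat_kernel ::
    "'a set \<Rightarrow> ('a set \<Rightarrow> 'a set \<Rightarrow> real) \<Rightarrow> real \<Rightarrow> ('a \<Rightarrow>\<^sub>0 int) \<Rightarrow> ('a \<Rightarrow>\<^sub>0 int) \<Rightarrow> complex" where
  "heat_kernel A w t \<alpha> \<beta> = (\<integral>\<theta>. character A \<theta> (\<alpha> - \<beta>) \<partial>heat_measure A w t)"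

definition heat_prob ::
    "'a set \<Rightarrow> ('a set \<Rightarrow> 'a set \<Rightarrow> real) \<Rightarrow> real \<Rightarrow> ('a \<Rightarrow> real) set measure" where
  "heat_prob A w t =
     scale_measure (inverse (emeasure (heat_measure A w t) (torus (- A)))) (heat_measure A w t)"

text \<open>
  \<open>R\<close> is the cardinality of the index type \<open>'r\<close>, and \<open>\<real>\<^sup>2\<^sup>R\<close> is the Euclidean space
  \<open>(\<real> \<times> \<real>)\<^sup>R\<close>, whose inner product is the sum of the products of all \<open>2R\<close> real coordinates.
\<close>

definition random_features ::
    "'a set \<Rightarrow> ('a set \<Rightarrow> 'a set \<Rightarrow> real) \<Rightarrow> real \<Rightarrow> ('r::finite \<Rightarrow> ('a \<Rightarrow> real) set) \<Rightarrow>
     ('a \<Rightarrow>\<^sub>0 int) \<Rightarrow> (real \<times> real) ^ 'r" where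
  "random_features A w t \<theta> \<alpha> =
     sqrt (measure (heat_measure A w t) (torus (- A)) / real CARD('r)) *\<^sub>R
       (\<chi> r. (cos (pairing A \<alpha> (\<theta> r)), sin (pairing A \<alpha> (\<theta> r))))"

end

theory Submission
  imports Defs
begin

text \<open>
  The inner product of the features is the average over \<open>r\<close> of \<open>cos \<langle>\<alpha> - \<beta>, \<theta>\<^sub>r\<rangle>\<close>, scaled by the
  total mass of the heat measure, so its expectation is the real part of the heat kernel.
  The kernel is real: the reflection \<open>\<theta> \<mapsto> - \<theta>\<close> preserves both the Haar measure and the energy
  and conjugates the characters.
\<close>

section \<open>Scaling and reflection of measures\<close>

text \<open>Scaling by a finite factor is a constant density. This carries integrals from the
  normalized \<open>heat_prob\<close> back to \<open>heat_measure\<close>.\<close>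

lemma integral_scale_measure:
  fixes f :: "'a \<Rightarrow> 'b::{banach, second_countable_topology}"
  assumes "f \<in> borel_measurable M" and "0 \<le> c"
  shows "integral\<^sup>L (scale_measure (ennreal c) M) f = c *\<^sub>R integral\<^sup>L M f"
proof -
  have "scale_measure (ennreal c) M = density M (\<lambda>_. ennreal c)"
    by (rule measure_eqI) (auto simp: emeasure_density_const)
  then show ?thesis
    using assms by (simp add: integral_density)
qed

text \<open>Lebesgue measure is invariant under the reflection, which exchanges the half-open
  intervals \<open>{0..<c}\<close> and \<open>{0<..c}\<close>; these differ only by a null
  set.\<close>

lemma distr_uniform_measure_reflect:
  fixes c :: real
  shows "distr (uniform_measure lborel {0..<c}) borel (\<lambda>x. c - x) = uniform_measure lborel {0..<c}"
proof (rule measure_eqI)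
  fix X assume "X \<in> sets (distr (uniform_measure lborel {0..<c}) borel (\<lambda>x. c - x))"
  then have X [measurable]: "X \<in> sets borel"
    by simp
  have pre: "(\<lambda>x. c - x) -` X \<in> sets borel"
    by (rule measurable_sets_borel[OF _ X]) measurable
  \<comment> \<open>The affine change of variables with slope -1 has Jacobian factor 1.\<close>
  have refl: "distr lborel borel (\<lambda>x. c - x) = (lborel :: real measure)"
    using lborel_real_affine[of "-1" c] by (simp add: density_1)
  have "emeasure lborel ({0..<c} \<inter> (\<lambda>x. c - x) -` X)
          = emeasure (distr lborel borel (\<lambda>x. c - x)) ({0<..c} \<inter> X)"
    by (subst emeasure_distr) (auto intro!: arg_cong[of _ _ "emeasure lborel"])
  also have "\<dots> = emeasure lborel ({0<..c} \<inter> X)"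
    by (simp add: refl)
  \<comment> \<open>The two sets can disagree only at the endpoints 0 and c, each of Lebesgue
    measure zero.\<close>
  also have "\<dots> = emeasure lborel ({0..<c} \<inter> X)"
    using AE_lborel_singleton[of 0] AE_lborel_singleton[of c]
    by (intro emeasure_eq_AE) (auto elim!: eventually_elim2)
  finally show "emeasure (distr (uniform_measure lborel {0..<c}) borel (\<lambda>x. c - x)) X
      = emeasure (uniform_measure lborel {0..<c}) X"
    using pre by (subst emeasure_distr) simp_all
qed simp

section \<open>The quotient sigma-algebra and Haar integrals\<close>

lemma space_torus_borel: "space (torus_borel I) = torus I"
  unfolding torus_borel_def by (rule space_measure_of) auto

lemma sets_heat_measure: "sets (heat_measure A w t) = sets (torus_borel (- A))"
  by (simp add: heat_measure_def haar_def)

text \<open>Universal property of the quotient: \<open>torus_borel\<close> contains every set whose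
  preimage under \<open>torus_class\<close> is Borel, so measurability may be tested on
  lifts.\<close>

lemma borel_measurable_torusI:
  assumes "(\<lambda>v. f (torus_class I v)) \<in> borel_measurable (Pi\<^sub>M I (\<lambda>_. borel))"
  shows "f \<in> borel_measurable (torus_borel I)"
proof (rule measurableI)
  fix S :: "'b set" assume S: "S \<in> sets borel"
  have "torus_class I -` (f -` S \<inter> torus I) \<inter> (I \<rightarrow>\<^sub>E UNIV)
          = (\<lambda>v. f (torus_class I v)) -` S \<inter> space (Pi\<^sub>M I (\<lambda>_. borel))"
    by (auto simp: space_PiM torus_def torus_class_def quotient_def)
  also have "\<dots> \<in> sets (Pi\<^sub>M I (\<lambda>_. borel))"
    using assms S by (rule measurable_sets)
  finally have "f -` S \<inter> torus I \<in>
      {B. B \<subseteq> torus I \<and> torus_class I -` B \<inter> (I \<rightarrow>\<^sub>E UNIV) \<in> sets (Pi\<^sub>M I (\<lambda>_. borel))}"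
    by auto
  then show "f -` S \<inter> space (torus_borel I) \<in> sets (torus_borel I)"
    unfolding space_torus_borel unfolding torus_borel_def
    by (subst sets_measure_of) (auto intro: sigma_sets.Basic)
qed simp

text \<open>Invariance of Haar measure under negation, proved upstairs on the cube. Negation is
  represented there by 2 pi - x in each coordinate, which stays in the cube up to a null set.
  Relating \<open>f\<close> and \<open>g\<close> through lifts avoids defining negation on
  cosets.\<close>

lemma integral_haar_reflect:
  fixes f :: "('i \<Rightarrow> real) set \<Rightarrow> 'b::{banach, second_countable_topology}"
    and g :: "('i \<Rightarrow> real) set \<Rightarrow> 'b"
  assumes "finite I" and f: "f \<in> borel_measurable (torus_borel I)"
    and g: "g \<in> borel_measurable (torus_borel I)"
    and fg: "\<And>v. v \<in> (I \<rightarrow>\<^sub>E UNIV) \<Longrightarrow>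
           f (torus_class I (compose I (\<lambda>x. 2 * pi - x) v)) = g (torus_class I v)"
  shows "integral\<^sup>L (haar I) f = integral\<^sup>L (haar I) g"
proof -
  let ?U = "uniform_measure lborel {0..<2 * pi} :: real measure"
  let ?P = "Pi\<^sub>M I (\<lambda>_. ?U)"
  let ?\<rho> = "compose I (\<lambda>x. 2 * pi - x) :: ('i \<Rightarrow> real) \<Rightarrow> 'i \<Rightarrow> real"
  have U: "prob_space ?U"
    by (rule prob_space_uniform_measure) auto
  have "distr ?P ?P ?\<rho> = Pi\<^sub>M I (\<lambda>_. distr ?U ?U (\<lambda>x. 2 * pi - x))"
    using assms(1) U by (intro distr_PiM_finite_prob_space') auto
  \<comment> \<open>\<open>?U\<close> and \<open>borel\<close> have the same measurable sets, so
    changing the target changes nothing and the one-dimensional reflection lemma applies.\<close>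
  also have "distr ?U ?U (\<lambda>x. 2 * pi - x) = distr ?U borel (\<lambda>x. 2 * pi - x)"
    by (rule distr_cong) auto
  finally have P: "distr ?P ?P ?\<rho> = ?P"
    by (simp add: distr_uniform_measure_reflect)
  have \<rho>: "?\<rho> \<in> measurable ?P ?P"
    unfolding compose_def by measurable
  have cls: "torus_class I \<in> measurable ?P (torus_borel I)"
    by (rule torus_class_measurable)
  have fc: "(\<lambda>v. f (torus_class I v)) \<in> borel_measurable ?P"
    using measurable_compose[OF cls f] .
  have "integral\<^sup>L (haar I) f = (\<integral>v. f (torus_class I v) \<partial>?P)"
    unfolding haar_def by (rule integral_distr[OF cls f])
  also have "\<dots> = (\<integral>v. f (torus_class I v) \<partial>distr ?P ?P ?\<rho>)"
    by (simp only: P)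
  also have "\<dots> = (\<integral>v. f (torus_class I (?\<rho> v)) \<partial>?P)"
    by (rule integral_distr[OF \<rho> fc])
  also have "\<dots> = (\<integral>v. g (torus_class I v) \<partial>?P)"
    by (intro Bochner_Integration.integral_cong) (auto simp: space_PiM fg)
  also have "\<dots> = integral\<^sup>L (haar I) g"
    unfolding haar_def by (rule integral_distr[OF cls g, symmetric])
  finally show ?thesis .
qed

section \<open>Measurability of characters, phases and energy\<close>

text \<open>\<open>angles\<close> rests on an arbitrary choice of representatives, so measurability
  is tested on lifts, where \<open>character_class\<close> replaces the choice by a continuous
  function of finitely many coordinates.\<close>

lemma character_measurable:
  assumes "finite (- A)"
  shows "(\<lambda>\<theta>. character A \<theta> \<gamma>) \<in> borel_measurable (torus_borel (- A))"
proof (rule borel_measurable_torusI)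
  have "(\<lambda>v. cis (\<Sum>x\<in>- A. of_int (Poly_Mapping.lookup \<gamma> x) * v x))
          \<in> borel_measurable (Pi\<^sub>M (- A) (\<lambda>_. borel))"
    unfolding cis_conv_exp by measurable
  then show "(\<lambda>v. character A (torus_class (- A) v) \<gamma>)
      \<in> borel_measurable (Pi\<^sub>M (- A) (\<lambda>_. borel))"
    by (rule measurable_cong[THEN iffD1, rotated])
       (simp add: space_PiM character_class[OF assms])
qed

lemma phase_measurable:
  assumes "A \<noteq> {}" and "P \<in> collapse A"
  shows "(\<lambda>\<theta>. phase A \<theta> P) \<in> borel_measurable (torus_borel (- A))"
proof (rule borel_measurable_torusI)
  consider "P = A" | x where "x \<notin> A" "P = {x}"
    using assms by (auto simp: collapse_eq)
  then show "(\<lambda>v. phase A (torus_class (- A) v) P) \<in> borel_measurable (Pi\<^sub>M (- A) (\<lambda>_. borel))"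
  proof cases
    case 1
    then show ?thesis
      by (simp add: phase_def)
  next
    case 2
    then have [measurable]: "(\<lambda>v. v x) \<in> borel_measurable (Pi\<^sub>M (- A) (\<lambda>_. borel :: real measure))"
      by (intro measurable_component_singleton) simp
    have "(\<lambda>v. cis (v x)) \<in> borel_measurable (Pi\<^sub>M (- A) (\<lambda>_. borel))"
      unfolding cis_conv_exp by measurable
    then show ?thesis
      by (rule measurable_cong[THEN iffD1, rotated])
         (use 2 in \<open>simp add: space_PiM phase_class(2)[OF assms(1)]\<close>)
  qed
qed

lemma dirichlet_energy_measurable:
  assumes "A \<noteq> {}"
  shows "dirichlet_energy A w \<in> borel_measurable (torus_borel (- A))"
  unfolding dirichlet_energy_def
  by (intro borel_measurable_times borel_measurable_sum borel_measurable_power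
      measurable_compose[OF _ borel_measurable_norm] borel_measurable_diff borel_measurable_const phase_measurable assms)

section \<open>Effect of the reflection and reality of the kernel\<close>

lemma cis_2pi_minus: "cis (2 * pi - x) = cnj (cis x)"
  using cis_add_2pi[of "- x" 1] by (simp add: cis_cnj)

lemma compose_PiE_UNIV: "compose I f v \<in> (I \<rightarrow>\<^sub>E UNIV)"
  by (simp add: compose_def)

text \<open>The coefficients are integers, so the shifts by 2 pi contribute multiples of 2 pi and
  only the sign change remains.\<close>

lemma character_reflect:
  assumes "finite (- A)" and "v \<in> (- A \<rightarrow>\<^sub>E UNIV)"
  shows "character A (torus_class (- A) (compose (- A) (\<lambda>x. 2 * pi - x) v)) \<gamma>
           = cnj (character A (torus_class (- A) v) \<gamma>)"
proof -
  have "cis (of_int n * (2 * pi - y)) = cnj (cis (of_int n * y))" for n :: int and y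
    using cis_add_2pi[of "- (of_int n * y)" n] by (simp add: cis_cnj algebra_simps)
  then show ?thesis
    using assms by (simp add: character_class compose_PiE_UNIV cis_sum compose_eq)
qed

lemma phase_reflect:
  assumes "A \<noteq> {}" and "P \<in> collapse A" and "v \<in> (- A \<rightarrow>\<^sub>E UNIV)"
  shows "phase A (torus_class (- A) (compose (- A) (\<lambda>x. 2 * pi - x) v)) P
           = cnj (phase A (torus_class (- A) v) P)"
  using assms(2,3)
  by (auto simp: collapse_eq[OF assms(1)] phase_class[OF assms(1)] compose_PiE_UNIV
      compose_eq cis_2pi_minus)

text \<open>All phases are conjugated simultaneously, which leaves the modulus of each difference
  unchanged.\<close>

lemma dirichlet_energy_reflect:
  assumes "A \<noteq> {}" and "v \<in> (- A \<rightarrow>\<^sub>E UNIV)"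
  shows "dirichlet_energy A w (torus_class (- A) (compose (- A) (\<lambda>x. 2 * pi - x) v))
           = dirichlet_energy A w (torus_class (- A) v)"
  using assms
  by (simp add: dirichlet_energy_def phase_reflect complex_cnj_diff[symmetric]
      del: complex_cnj_diff cong: sum.cong)

lemma cnj_heat_kernel:
  assumes "A \<noteq> {}" and "finite (- A)"
  shows "cnj (heat_kernel A w t \<alpha> \<beta>) = heat_kernel A w t \<alpha> \<beta>"
proof -
  let ?e = "\<lambda>\<theta>. exp (- t * dirichlet_energy A w \<theta>)"
  let ?c = "\<lambda>\<theta>. character A \<theta> (\<alpha> - \<beta>)"
  have [measurable]: "?c \<in> borel_measurable (torus_borel (- A))"
      "dirichlet_energy A w \<in> borel_measurable (torus_borel (- A))"
    using assms by (auto intro: character_measurable dirichlet_energy_measurable)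
  have [measurable_cong]: "sets (haar (- A)) = sets (torus_borel (- A))"
    by (simp add: haar_def)
  have k: "heat_kernel A w t \<alpha> \<beta> = (\<integral>\<theta>. ?e \<theta> *\<^sub>R ?c \<theta> \<partial>haar (- A))"
    unfolding heat_kernel_def heat_measure_def by (rule integral_density) auto
  \<comment> \<open>The reflection fixes the real weight and conjugates the character. The integral
    rules used hold for measurable integrands without a separate integrability check.\<close>
  also have "\<dots> = (\<integral>\<theta>. cnj (?e \<theta> *\<^sub>R ?c \<theta>) \<partial>haar (- A))"
  proof (rule integral_haar_reflect[OF assms(2)])
    have "cnj \<in> borel_measurable borel"
      by (intro borel_measurable_continuous_onI continuous_intros)
    then show "(\<lambda>\<theta>. cnj (?e \<theta> *\<^sub>R ?c \<theta>)) \<in> borel_measurable (torus_borel (- A))"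
      by (rule measurable_compose[rotated]) measurable
  qed (use assms in \<open>auto simp: character_reflect dirichlet_energy_reflect\<close>)
  also have "\<dots> = cnj (heat_kernel A w t \<alpha> \<beta>)"
    by (simp only: k Bochner_Integration.integral_cnj)
  finally show ?thesis ..
qed

section \<open>Total mass of the heat measure\<close>

text \<open>Nonnegative energy makes the density at most 1 against a probability measure, and an
  exponential never vanishes. Hence the normalization in \<open>heat_prob\<close> divides by a
  finite nonzero number.\<close>

lemma emeasure_heat_measure_bounds:
  assumes "A \<noteq> {}" and "0 \<le> t"
    and w: "\<And>u v. u \<in> collapse A \<Longrightarrow> v \<in> collapse A \<Longrightarrow> 0 \<le> w u v"
  shows "emeasure (heat_measure A w t) (torus (- A)) \<le> 1"
    and "emeasure (heat_measure A w t) (torus (- A)) \<noteq> 0"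
proof -
  interpret haar: prob_space "haar (- A)"
    by (rule prob_space_haar)
  let ?e = "\<lambda>\<theta>. exp (- t * dirichlet_energy A w \<theta>)"
  have [measurable]: "dirichlet_energy A w \<in> borel_measurable (torus_borel (- A))"
    using assms(1) by (rule dirichlet_energy_measurable)
  have [measurable_cong]: "sets (haar (- A)) = sets (torus_borel (- A))"
    and sp: "space (haar (- A)) = torus (- A)"
    by (simp_all add: haar_def space_torus_borel)
  have mass: "emeasure (heat_measure A w t) (torus (- A)) = (\<integral>\<^sup>+\<theta>. ennreal (?e \<theta>) \<partial>haar (- A))"
    unfolding heat_measure_def sp[symmetric]
    by (subst emeasure_density) (auto intro!: nn_integral_cong)
  have "?e \<theta> \<le> 1" for \<theta>
    using assms(2) w by (auto simp: dirichlet_energy_def intro!: mult_nonneg_nonneg sum_nonneg)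
  then have "(\<integral>\<^sup>+\<theta>. ennreal (?e \<theta>) \<partial>haar (- A)) \<le> (\<integral>\<^sup>+\<theta>. 1 \<partial>haar (- A))"
    by (intro nn_integral_mono) simp
  then show "emeasure (heat_measure A w t) (torus (- A)) \<le> 1"
    by (simp add: mass haar.emeasure_space_1)
  show "emeasure (heat_measure A w t) (torus (- A)) \<noteq> 0"
    \<comment> \<open>A zero integral would force the exponential to vanish almost everywhere, which
      is impossible on a probability space.\<close>
    unfolding mass by (subst nn_integral_0_iff_AE) (auto simp: haar.AE_False)
qed

section \<open>Inner product of features and its expectation\<close>

text \<open>The two square-root prefactors multiply to the mass over R, and in each block the cosine
  difference formula merges the cosine and sine products.\<close>

lemma inner_random_features:
  fixes \<theta> :: "'r::finite \<Rightarrow> ('a \<Rightarrow> real) set"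
  shows "random_features A w t \<theta> \<alpha> \<bullet> random_features A w t \<theta> \<beta>
    = measure (heat_measure A w t) (torus (- A)) / real CARD('r) *
        (\<Sum>r\<in>UNIV. Re (character A (\<theta> r) (\<alpha> - \<beta>)))"
proof -
  define m where "m = measure (heat_measure A w t) (torus (- A)) / real CARD('r)"
  have s: "sqrt m * x * (sqrt m * y) = m * (x * y)" for x y
  proof -
    have "sqrt m * x * (sqrt m * y) = (sqrt m * sqrt m) * (x * y)"
      by (simp only: mult_ac)
    then show ?thesis
      by (simp add: m_def)
  qed
  have "pairing A (\<alpha> - \<beta>) \<eta> = pairing A \<alpha> \<eta> - pairing A \<beta> \<eta>" for \<eta>
    by (simp add: pairing_def lookup_minus algebra_simps sum_subtractf)
  then have "Re (character A \<eta> (\<alpha> - \<beta>)) = cos (pairing A \<alpha> \<eta>) * cos (pairing A \<beta> \<eta>)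
      + sin (pairing A \<alpha> \<eta>) * sin (pairing A \<beta> \<eta>)" for \<eta>
    by (simp add: character_def cos_diff)
  then show ?thesis
    unfolding random_features_def m_def[symmetric]
    by (simp only: inner_vec_def vector_scaleR_component vec_lambda_beta scaleR_Pair inner_Pair
        inner_real_def real_scaleR_def s distrib_left[symmetric] sum_distrib_left)
qed

theorem lemma6p3:
  fixes A :: "'a::metric_space set"
    and H :: "'a set pair_pre_digraph"
    and w :: "'a set \<Rightarrow> 'a set \<Rightarrow> real"
    and t :: real
    and M :: "'w measure"
    and \<theta> :: "'r::finite \<Rightarrow> 'w \<Rightarrow> ('a \<Rightarrow> real) set"
    and \<alpha> \<beta> :: "'a \<Rightarrow>\<^sub>0 int"
  assumes "A \<noteq> {}" and "finite (- A)" and "- A \<noteq> {}"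
    and "Metric_space (collapse A) (d1_bar A)"
    and "pair_graph H" and "pverts H = collapse A"
    and "Digraph_Component.connected (with_proj H)"
    and "\<And>u v. u \<in> collapse A \<Longrightarrow> v \<in> collapse A \<Longrightarrow>
           wf_digraph.\<mu> (with_proj H) (\<lambda>(x, y). d1_bar A x y) u v = ereal (d1_bar A u v)"
    and "\<And>u v. u \<in> collapse A \<Longrightarrow> v \<in> collapse A \<Longrightarrow> w u v = w v u"
    and "\<And>u v. (u, v) \<in> parcs H \<Longrightarrow> w u v > 0"
    and "\<And>u v. u \<in> collapse A \<Longrightarrow> v \<in> collapse A \<Longrightarrow> (u, v) \<notin> parcs H \<Longrightarrow> w u v = 0"
    and "t > 0"
    and "prob_space M"
    and "prob_space.indep_vars M (\<lambda>_. torus_borel (- A)) \<theta> UNIV"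
    and "\<And>r. distr M (torus_borel (- A)) (\<theta> r) = heat_prob A w t"
    and "\<alpha> \<in> carrier (vpd_group A)" and "\<beta> \<in> carrier (vpd_group A)"
  shows "complex_of_real
           (\<integral>\<omega>. random_features A w t (\<lambda>r. \<theta> r \<omega>) \<alpha> \<bullet> random_features A w t (\<lambda>r. \<theta> r \<omega>) \<beta> \<partial>M)
         = heat_kernel A w t \<alpha> \<beta>"
proof -
  interpret M: prob_space M
    by (rule assms)
  let ?H = "heat_measure A w t" and ?T = "torus (- A)"
  let ?c = "\<lambda>\<eta>. character A \<eta> (\<alpha> - \<beta>)"
  \<comment> \<open>Conductances are positive on arcs and zero elsewhere.\<close>
  have w: "0 \<le> w u v" if "u \<in> collapse A" "v \<in> collapse A" for u v
    using assms(10)[of u v] assms(11)[of u v] that by fastforce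
  have mass: "emeasure ?H ?T \<le> 1" "emeasure ?H ?T \<noteq> 0"
    using emeasure_heat_measure_bounds[OF assms(1) _ w] assms(12) by auto
  then have fin: "emeasure ?H ?T = ennreal (measure ?H ?T)"
    by (intro emeasure_eq_ennreal_measure) (auto simp: top_unique)
  with mass have m: "0 < measure ?H ?T"
    by (auto simp: zero_less_measure_iff)
  have heat: "heat_prob A w t = scale_measure (ennreal (1 / measure ?H ?T)) ?H"
    using m by (simp add: heat_prob_def fin inverse_ennreal inverse_eq_divide)
  have rv: "\<theta> r \<in> measurable M (torus_borel (- A))" for r
    using assms(14) by (auto simp: M.indep_vars_def)
  have c: "?c \<in> borel_measurable (torus_borel (- A))"
    using assms(2) by (rule character_measurable)
  have cH: "?c \<in> borel_measurable ?H"
    using c by (simp add: measurable_cong_sets[OF sets_heat_measure refl])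
  \<comment> \<open>Characters have modulus 1, hence are bounded on a probability space.\<close>
  have int: "integrable M (\<lambda>\<omega>. ?c (\<theta> r \<omega>))" for r
    using measurable_compose[OF rv c]
    by (intro M.integrable_const_bound[of _ 1]) (auto simp: character_def)
  \<comment> \<open>Transfer to the law of \<open>\<theta> r\<close>, which is
    \<open>heat_prob\<close>; the division by the mass is its normalization.\<close>
  have E: "(\<integral>\<omega>. ?c (\<theta> r \<omega>) \<partial>M) = heat_kernel A w t \<alpha> \<beta> / measure ?H ?T" for r
  proof -
    have "(\<integral>\<omega>. ?c (\<theta> r \<omega>) \<partial>M) = integral\<^sup>L (heat_prob A w t) ?c"
      unfolding assms(15)[of r, symmetric] by (rule integral_distr[OF rv c, symmetric])
    also have "\<dots> = (1 / measure ?H ?T) *\<^sub>R heat_kernel A w t \<alpha> \<beta>"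
      unfolding heat heat_kernel_def using m by (intro integral_scale_measure cH) simp
    finally show ?thesis
      by (simp add: scaleR_conv_of_real)
  qed
  have "(\<integral>\<omega>. random_features A w t (\<lambda>r. \<theta> r \<omega>) \<alpha> \<bullet> random_features A w t (\<lambda>r. \<theta> r \<omega>) \<beta> \<partial>M)
      = measure ?H ?T / real CARD('r) * (\<Sum>r\<in>UNIV. \<integral>\<omega>. Re (?c (\<theta> r \<omega>)) \<partial>M)"
    unfolding inner_random_features using int by simp
  \<comment> \<open>Each of the R equal summands contributes the real part of the kernel over the
    mass, so the prefactor cancels.\<close>
  also have "\<dots> = Re (heat_kernel A w t \<alpha> \<beta>)"
    using m by (simp add: integral_Re[OF int] E)
  finally show ?thesis
    \<comment> \<open>A number equal to its conjugate has zero imaginary part, so the real part is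
      the whole kernel.\<close>
    using cnj_heat_kernel[OF assms(1,2), of w t \<alpha> \<beta>]
    by (simp add: complex_eq_iff)
qed

end
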